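(* Let $k$ be a positive integer and let $\rho\neq0$ be real. For $0\le n\le k-1$ put $$D_n=\sum_{\ell=0}^n(-1)^\ell\rho^{\,n-\ell}\,s_k^{(k-\ell)}\,S_{k-\ell}^{(k-n)} .$$ Then for every real $x\neq 0$, $${}_1\Psi_1(\rho,k;\rho,0;x)=(\rho x)^k e^x\sum_{n=0}^{k-1}D_n\,(\rho x)^{-n}.$$
   Context: For a positive integer $k$, real $\rho\ne0$ and real $x$, ${}_1\Psi_1(\rho,k;\rho,0;x)=\sum_{n=0}^\infty \frac{\Gamma(k+\rho n)}{\Gamma(\rho n)}\frac{x^n}{n!}$, where the quotient $\Gamma(k+\rho n)/\Gamma(\rho n)$ is understood (by a limit where necessary) as $\prod_{j=0}^{k-1}(\rho n+j)$. $s_k^{(m)}$ denotes the (signed) Stirling numbers of the first kind, defined by $y(y-1)\cdots(y-k+1)=\sum_{m=0}^k s_k^{(m)}y^m$, and $S_m^{(r)}$ the Stirling numbers of the second kind, defined by $y^m=\sum_{r=0}^m S_m^{(r)}\,y(y-1)\cdots(y-r+1)$. *)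

theory Defs
  imports
    "HOL-Analysis.Analysis"
    "HOL-Computational_Algebra.Polynomial"
    "HOL-Combinatorics.Stirling"
begin

text \<open>The library's \<open>stirling\<close> is unsigned; the signed numbers of the first kind are the
  coefficients of the falling factorial \<open>y (y - 1) \<cdots> (y - k + 1)\<close>.\<close>

definition stirling_signed :: "nat \<Rightarrow> nat \<Rightarrow> int" where
  "stirling_signed k m = coeff (\<Prod>j<k. [:- int j, 1:]) m"

lemma falling_factorial_stirling_signed:
  fixes y :: "'a :: comm_ring_1"
  shows "(\<Prod>j<k. y - of_nat j) = (\<Sum>m\<le>k. of_int (stirling_signed k m) * y ^ m)"
proof -
  define q where "q k = (\<Prod>j<k. [:- int j, 1:])" for k
  have deg: "degree (q k) \<le> k"
  proof -
    have "degree (q k) \<le> (\<Sum>j<k. degree [:- int j, 1:])"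
      using degree_prod_sum_le[of "{..<k}" "\<lambda>j. [:- int j, 1:]"] by (simp add: q_def)
    also have "\<dots> = k" by simp
    finally show ?thesis .
  qed
  have "poly (map_poly of_int (q k)) y = (\<Prod>j<k. y - of_nat j)"
  proof (induction k)
    case 0
    show ?case by (simp add: q_def)
  next
    case (Suc k)
    have "q (Suc k) = q k * [:- int k, 1:]" by (simp add: q_def)
    also have "\<dots> = smult (- int k) (q k) + pCons 0 (q k)" by simp
    finally have "map_poly of_int (q (Suc k)) =
        smult (- of_nat k) (map_poly of_int (q k)) + pCons 0 (map_poly (of_int :: int \<Rightarrow> 'a) (q k))"
      by (intro poly_eqI) (simp add: coeff_map_poly coeff_pCons split: nat.split)
    then have "poly (map_poly of_int (q (Suc k))) y =
        - of_nat k * poly (map_poly of_int (q k)) y + y * poly (map_poly of_int (q k)) y"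
      by simp
    then show ?case by (simp add: Suc algebra_simps)
  qed
  moreover have "degree (map_poly (of_int :: int \<Rightarrow> 'a) (q k)) \<le> k"
    using deg map_poly_degree_leq order_trans by blast
  then have "poly (map_poly of_int (q k)) y =
      poly (\<Sum>m\<le>k. monom (coeff (map_poly of_int (q k)) m) m) y"
    by (simp add: poly_as_sum_of_monoms')
  then have "poly (map_poly of_int (q k)) y = (\<Sum>m\<le>k. of_int (coeff (q k) m) * y ^ m)"
    by (simp add: poly_sum poly_monom coeff_map_poly)
  ultimately show ?thesis by (simp add: stirling_signed_def q_def)
qed

text \<open>The library's \<open>Stirling\<close> (capitalised) is the number of the second kind.\<close>

lemma power_eq_sum_Stirling:
  fixes y :: "'a :: comm_ring_1"
  shows "y ^ m = (\<Sum>r\<le>m. of_nat (Stirling m r) * (\<Prod>j<r. y - of_nat j))"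
proof (induction m)
  case 0
  show ?case by simp
next
  case (Suc m)
  define p where "p r = (\<Prod>j<r. y - of_nat j)" for r
  have p: "y * p r = p (Suc r) + of_nat r * p r" for r
    by (simp add: p_def algebra_simps)
  have "y ^ Suc m = (\<Sum>r\<le>m. of_nat (Stirling m r) * (y * p r))"
    using Suc by (simp add: p_def sum_distrib_left algebra_simps)
  also have "\<dots> = (\<Sum>r\<le>m. of_nat (Stirling m r) * p (Suc r)) +
      (\<Sum>r\<le>Suc m. of_nat (r * Stirling m r) * p r)"
    by (simp add: p sum.distrib algebra_simps)
  also have "(\<Sum>r\<le>Suc m. of_nat (r * Stirling m r) * p r) =
      (\<Sum>r\<le>m. of_nat (Suc r * Stirling m (Suc r)) * p (Suc r))"
    by (subst sum.atMost_Suc_shift) simp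
  finally have "y ^ Suc m = (\<Sum>r\<le>m. of_nat (Stirling (Suc m) (Suc r)) * p (Suc r))"
    by (simp add: sum.distrib[symmetric] algebra_simps)
  also have "\<dots> = (\<Sum>r\<le>Suc m. of_nat (Stirling (Suc m) r) * p r)"
    by (subst sum.atMost_Suc_shift) simp
  finally show ?case by (simp only: p_def)
qed

text \<open>\<open>wright_psi \<rho> k x\<close> is \<open>\<^sub>1\<Psi>\<^sub>1(\<rho>, k; \<rho>, 0; x)\<close>. The quotient
  \<open>\<Gamma>(k + \<rho> n) / \<Gamma>(\<rho> n)\<close> may involve poles (always for \<open>n = 0\<close>), where it stands for its
  limit, i.e. the product of the \<open>\<rho> n + j\<close> over \<open>j < k\<close>; see \<open>Gamma_quotient_tendsto\<close>.\<close>

definition wright_psi :: "real \<Rightarrow> nat \<Rightarrow> real \<Rightarrow> real" where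
  "wright_psi \<rho> k x = (\<Sum>n. (\<Prod>j<k. \<rho> * real n + real j) * x ^ n / fact n)"

lemma Gamma_quotient_eq:
  fixes z :: real
  assumes "z \<notin> \<int>\<^sub>\<le>\<^sub>0"
  shows "Gamma (real k + z) / Gamma z = (\<Prod>j<k. z + real j)"
  using pochhammer_Gamma[OF assms, of k]
  by (simp add: pochhammer_prod atLeast0LessThan add.commute)

lemma Gamma_quotient_tendsto:
  fixes z :: real
  shows "((\<lambda>t. Gamma (real k + t) / Gamma t) \<longlongrightarrow> (\<Prod>j<k. z + real j)) (at z)"
proof (rule Lim_transform_eventually)
  show "((\<lambda>t. \<Prod>j<k. t + real j) \<longlongrightarrow> (\<Prod>j<k. z + real j)) (at z)"
    by (intro tendsto_intros)
  have "\<not> z islimpt (\<int>\<^sub>\<le>\<^sub>0 :: real set)"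
    by (rule discrete_imp_not_islimpt[of 1]) (auto elim!: nonpos_Ints_cases simp: dist_real_def)
  then have "\<forall>\<^sub>F t in at z. t \<notin> (\<int>\<^sub>\<le>\<^sub>0 :: real set)"
    by (simp add: islimpt_conv_frequently_at frequently_def)
  then show "\<forall>\<^sub>F t in at z. (\<Prod>j<k. t + real j) = Gamma (real k + t) / Gamma t"
    by eventually_elim (simp add: Gamma_quotient_eq)
qed

lemma wright_psi_summable:
  "summable (\<lambda>n. (\<Prod>j<k. \<rho> * real n + real j) * x ^ n / fact n)"
proof (rule summable_comparison_test')
  define c where "c = fact k * exp (real k)"
  show "summable (\<lambda>n. c * ((exp \<bar>\<rho>\<bar> * \<bar>x\<bar>) ^ n / fact n))"
    using summable_exp[of "exp \<bar>\<rho>\<bar> * \<bar>x\<bar>"]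
    by (intro summable_mult) (simp add: field_simps)
  fix n :: nat
  define u where "u = \<bar>\<rho>\<bar> * real n + real k"
  have u: "u \<ge> 0" by (simp add: u_def)
  have "\<bar>\<Prod>j<k. \<rho> * real n + real j\<bar> = (\<Prod>j<k. \<bar>\<rho> * real n + real j\<bar>)"
    by (simp add: abs_prod)
  also have "\<dots> \<le> (\<Prod>j<k. u)"
  proof (rule prod_mono, safe)
    fix j assume "j < k"
    have "\<bar>\<rho> * real n + real j\<bar> \<le> \<bar>\<rho> * real n\<bar> + \<bar>real j\<bar>" by (rule abs_triangle_ineq)
    also have "\<dots> \<le> u" using \<open>j < k\<close> by (simp add: u_def abs_mult)
    finally show "\<bar>\<rho> * real n + real j\<bar> \<le> u" .
  qed simp
  also have "\<dots> = fact k * (u ^ k / fact k)" by simp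
  also have "u ^ k / fact k \<le> exp u"
  proof -
    have "(\<Sum>i\<in>{k}. u ^ i /\<^sub>R fact i) \<le> (\<Sum>i. u ^ i /\<^sub>R fact i)"
      by (rule sum_le_suminf) (use u summable_exp_generic[of u] in auto)
    then show ?thesis by (simp add: exp_def field_simps)
  qed
  also have "fact k * exp u = c * exp \<bar>\<rho>\<bar> ^ n"
    by (simp add: u_def c_def exp_add exp_of_nat2_mult)
  finally have "\<bar>\<Prod>j<k. \<rho> * real n + real j\<bar> \<le> c * exp \<bar>\<rho>\<bar> ^ n" by simp
  then have "\<bar>\<Prod>j<k. \<rho> * real n + real j\<bar> * (\<bar>x\<bar> ^ n / fact n) \<le>
      c * exp \<bar>\<rho>\<bar> ^ n * (\<bar>x\<bar> ^ n / fact n)"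
    by (rule mult_right_mono) simp
  then show "norm ((\<Prod>j<k. \<rho> * real n + real j) * x ^ n / fact n) \<le>
      c * ((exp \<bar>\<rho>\<bar> * \<bar>x\<bar>) ^ n / fact n)"
    by (simp add: abs_mult power_abs power_mult_distrib)
qed

definition D_coeff :: "real \<Rightarrow> nat \<Rightarrow> nat \<Rightarrow> real" where
  "D_coeff \<rho> k n =
     (\<Sum>l\<le>n. (-1) ^ l * \<rho> ^ (n - l) * real_of_int (stirling_signed k (k - l))
             * real (Stirling (k - l) (k - n)))"

end

theory Submission
  imports Defs
begin

text \<open>Reflecting \<open>y\<close> to \<open>-y\<close> turns the rising factorial of \<open>\<rho> n\<close> into signed Stirling numbers of the
  first kind times powers of \<open>\<rho> n\<close>; those of the second kind then expand \<open>n ^ m\<close> into falling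
  factorials of \<open>n\<close>. Each falling factorial of degree \<open>r\<close> contributes \<open>x ^ r * exp x\<close> to the series,
  and the term \<open>r = 0\<close> is absent because the rising factorial vanishes at \<open>0\<close>.\<close>

lemma fact_mult_falling_factorial:
  "fact n * (\<Prod>j<r. real (n + r) - real j) = fact (n + r)"
proof (induction r)
  case (Suc r)
  \<comment> \<open>The factor split off is the first, \<open>j = 0\<close>: shifting
    \<open>j\<close> by one in the others lowers \<open>n + Suc r\<close> to \<open>n + r\<close>,
    so the induction hypothesis applies with the same \<open>n\<close>.\<close>
  have "(\<Prod>j<Suc r. real (n + Suc r) - real j) =
      real (n + Suc r) * (\<Prod>j<r. real (n + r) - real j)"
    by (subst prod.lessThan_Suc_shift) simp
  then have "fact n * (\<Prod>j<Suc r. real (n + Suc r) - real j) =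
      real (n + Suc r) * (fact n * (\<Prod>j<r. real (n + r) - real j))"
    by (simp only: mult.left_commute)
  then show ?case
    by (simp only: Suc.IH add_Suc_right fact_Suc)
qed simp

text \<open>The falling factorial cancels against the factorial in the denominator, leaving the
  exponential series delayed by \<open>r\<close> places.\<close>

lemma sums_falling_factorial_exp:
  fixes x :: real
  shows "(\<lambda>n. (\<Prod>j<r. real n - real j) * (x ^ n / fact n)) sums (x ^ r * exp x)"
proof -
  have "(\<lambda>n. x ^ r * (x ^ n / fact n)) sums (x ^ r * exp x)"
    using exp_converges[of x] by (intro sums_mult) (simp add: field_simps)
  moreover have "x ^ r * (x ^ n / fact n) =
      (\<Prod>j<r. real (n + r) - real j) * (x ^ (n + r) / fact (n + r))" for n
  proof -
    have "(\<Prod>j<r. real (n + r) - real j) = fact (n + r) / fact n"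
      using fact_mult_falling_factorial[of n r] by (simp add: field_simps del: of_nat_add)
    then show ?thesis
      by (simp add: power_add del: of_nat_add)
  qed
  ultimately have
    "(\<lambda>n. (\<Prod>j<r. real (n + r) - real j) * (x ^ (n + r) / fact (n + r))) sums (x ^ r * exp x)"
    by simp
  \<comment> \<open>The terms with \<open>n < r\<close> that the shift skips are zero: their product
    contains the factor \<open>j = n\<close>.\<close>
  then show ?thesis
    by (subst (asm) sums_zero_iff_shift) auto
qed

lemma rising_factorial_stirling_signed:
  fixes y :: real
  shows "(\<Prod>j<k. y + real j) =
    (\<Sum>l\<le>k. (-1) ^ l * real_of_int (stirling_signed k (k - l)) * y ^ (k - l))"
proof -
  have "(\<Prod>j<k. y + real j) = (\<Prod>j<k. (-1) * (- y - real j))"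
    by (simp add: add.commute)
  also have "\<dots> = (-1) ^ k * (\<Prod>j<k. - y - real j)"
    by (subst prod.distrib) simp
  also have "\<dots> = (\<Sum>m\<le>k. (-1) ^ k * (real_of_int (stirling_signed k m) * (- y) ^ m))"
    by (simp only: falling_factorial_stirling_signed sum_distrib_left)
  also have "\<dots> =
      (\<Sum>l\<le>k. (-1) ^ k * (real_of_int (stirling_signed k (k - l)) * (- y) ^ (k - l)))"
    by (rule sum.reindex_bij_witness[where i = "\<lambda>l. k - l" and j = "\<lambda>l. k - l"]) auto
  also have "\<dots> = (\<Sum>l\<le>k. (-1) ^ l * real_of_int (stirling_signed k (k - l)) * y ^ (k - l))"
  proof (rule sum.cong)
    \<comment> \<open>The \<open>k\<close> signs pulled out of the factors meet the
      \<open>k - l\<close> signs in the power of \<open>- y\<close>; only \<open>(-1) ^ l\<close>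
      survives, the sign appearing in \<open>D_coeff\<close>.\<close>
    fix l assume "l \<in> {..k}"
    then have "k = l + (k - l)" by simp
    then have "(-1) ^ k = (-1) ^ l * (-1 :: real) ^ (k - l)"
      by (metis power_add)
    moreover have "(-1) ^ (k - l) * (- y) ^ (k - l) = y ^ (k - l)"
      by (simp flip: power_mult_distrib)
    ultimately show "(-1) ^ k * (real_of_int (stirling_signed k (k - l)) * (- y) ^ (k - l)) =
        (-1) ^ l * real_of_int (stirling_signed k (k - l)) * y ^ (k - l)"
      by (simp add: algebra_simps)
  qed simp
  finally show ?thesis .
qed

text \<open>This identifies \<open>D_coeff\<close> as a connection coefficient, up to a power of
  \<open>\<rho>\<close>, between rising factorials in \<open>\<rho> * y\<close> and falling
  factorials in \<open>y\<close>; \<open>n\<close> counts the drop in degree from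
  \<open>k\<close>.\<close>

lemma rising_factorial_D_coeff:
  fixes \<rho> y :: real
  shows "(\<Prod>j<k. \<rho> * y + real j) =
    (\<Sum>n\<le>k. D_coeff \<rho> k n * \<rho> ^ (k - n) * (\<Prod>j<k - n. y - real j))"
proof -
  define p where "p r = (\<Prod>j<r. y - real j)" for r
  define c where "c l = (-1) ^ l * real_of_int (stirling_signed k (k - l))" for l
  have pow: "y ^ (k - l) = (\<Sum>n\<in>{l..k}. real (Stirling (k - l) (k - n)) * p (k - n))"
    if "l \<le> k" for l
  proof -
    have "y ^ (k - l) = (\<Sum>r\<le>k - l. real (Stirling (k - l) r) * p r)"
      by (simp only: power_eq_sum_Stirling[of y] p_def)
    also have "\<dots> = (\<Sum>n\<in>{l..k}. real (Stirling (k - l) (k - n)) * p (k - n))"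
      by (rule sum.reindex_bij_witness[where i = "\<lambda>n. k - n" and j = "\<lambda>n. k - n"])
        (use that in auto)
    finally show ?thesis .
  qed
  have "(\<Prod>j<k. \<rho> * y + real j) = (\<Sum>l\<le>k. c l * (\<rho> * y) ^ (k - l))"
    by (simp add: rising_factorial_stirling_signed c_def)
  also have "\<dots> = (\<Sum>l\<le>k. \<Sum>n\<in>{l..k}.
      c l * \<rho> ^ (k - l) * (real (Stirling (k - l) (k - n)) * p (k - n)))"
    by (intro sum.cong) (simp_all add: power_mult_distrib pow sum_distrib_left mult.assoc)
  \<comment> \<open>Both double sums run over the triangle \<open>l \<le> n \<le> k\<close>.\<close>
  also have "\<dots> = (\<Sum>n\<le>k. \<Sum>l\<le>n.
      c l * \<rho> ^ (k - l) * (real (Stirling (k - l) (k - n)) * p (k - n)))"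
    unfolding sum.Sigma[OF finite_atMost ballI[OF finite_atLeastAtMost]]
      sum.Sigma[OF finite_atMost ballI[OF finite_atMost]]
    by (rule sum.reindex_bij_witness[where i = prod.swap and j = prod.swap]) auto
  also have "\<dots> = (\<Sum>n\<le>k. D_coeff \<rho> k n * \<rho> ^ (k - n) * p (k - n))"
  proof (rule sum.cong)
    fix n assume n: "n \<in> {..k}"
    show "(\<Sum>l\<le>n. c l * \<rho> ^ (k - l) * (real (Stirling (k - l) (k - n)) * p (k - n))) =
        D_coeff \<rho> k n * \<rho> ^ (k - n) * p (k - n)"
      unfolding D_coeff_def sum_distrib_right
    proof (rule sum.cong)
      fix l assume "l \<in> {..n}"
      then have "\<rho> ^ (k - l) = \<rho> ^ (n - l) * \<rho> ^ (k - n)"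
        using n by (simp flip: power_add)
      then show "c l * \<rho> ^ (k - l) * (real (Stirling (k - l) (k - n)) * p (k - n)) =
          (-1) ^ l * \<rho> ^ (n - l) * real_of_int (stirling_signed k (k - l)) *
            real (Stirling (k - l) (k - n)) * \<rho> ^ (k - n) * p (k - n)"
        by (simp only: c_def mult_ac)
    qed simp
  qed simp
  finally show ?thesis
    by (simp only: p_def)
qed

text \<open>Evaluating the expansion at \<open>y = 0\<close> isolates this coefficient: falling
  factorials of positive degree vanish there, the empty product is 1, and the rising factorial
  contains the factor \<open>j = 0\<close>.\<close>

lemma D_coeff_self:
  assumes "k > 0"
  shows "D_coeff \<rho> k k = 0"
proof -
  have "(\<Prod>j<k - n. 0 - real j) = 0" if "n < k" for n
    using that by (auto simp: prod_zero_iff)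
  then have "(\<Sum>n<k. D_coeff \<rho> k n * \<rho> ^ (k - n) * (\<Prod>j<k - n. 0 - real j)) = 0"
    by (intro sum.neutral ballI) (simp only: lessThan_iff mult_zero_right)
  then have "D_coeff \<rho> k k = (\<Prod>j<k. \<rho> * 0 + real j)"
    unfolding rising_factorial_D_coeff by (simp add: sum.lessThan_Suc flip: lessThan_Suc_atMost)
  also have "\<dots> = 0"
    using assms by (auto simp: prod_zero_iff)
  finally show ?thesis .
qed

theorem mainTheorem4:
  fixes k :: nat and \<rho> x :: real
  assumes "k > 0" and "\<rho> \<noteq> 0" and "x \<noteq> 0"
  shows "wright_psi \<rho> k x =
    (\<rho> * x) ^ k * exp x * (\<Sum>n=0..k-1. D_coeff \<rho> k n * (\<rho> * x) powi (- int n))"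
proof -
  \<comment> \<open>The sum over \<open>n\<close> is finite, so it passes through the series term by
    term.\<close>
  have "(\<lambda>N. \<Sum>n\<le>k. D_coeff \<rho> k n * \<rho> ^ (k - n) *
        ((\<Prod>j<k - n. real N - real j) * (x ^ N / fact N)))
      sums (\<Sum>n\<le>k. D_coeff \<rho> k n * \<rho> ^ (k - n) * (x ^ (k - n) * exp x))"
    by (intro sums_sum sums_mult sums_falling_factorial_exp)
  moreover have "(\<Sum>n\<le>k. D_coeff \<rho> k n * \<rho> ^ (k - n) *
        ((\<Prod>j<k - n. real N - real j) * (x ^ N / fact N))) =
      (\<Prod>j<k. \<rho> * real N + real j) * x ^ N / fact N" for N
    by (simp only: rising_factorial_D_coeff sum_distrib_right mult.assoc times_divide_eq_right
        sum_divide_distrib)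
  ultimately have "wright_psi \<rho> k x =
      (\<Sum>n\<le>k. D_coeff \<rho> k n * \<rho> ^ (k - n) * (x ^ (k - n) * exp x))"
    by (simp add: wright_psi_def sums_iff)
  also have "\<dots> = (\<Sum>n<k. D_coeff \<rho> k n * \<rho> ^ (k - n) * (x ^ (k - n) * exp x))"
    by (simp add: D_coeff_self assms(1) flip: lessThan_Suc_atMost)
  also have "\<dots> = (\<Sum>n<k. (\<rho> * x) ^ k * exp x * (D_coeff \<rho> k n * (\<rho> * x) powi (- int n)))"
  proof (rule sum.cong)
    fix n assume "n \<in> {..<k}"
    \<comment> \<open>Dividing by \<open>(\<rho> * x) ^ n\<close> uses that \<open>\<rho>\<close>
      and \<open>x\<close> are nonzero.\<close>
    then have "(\<rho> * x) ^ (k - n) = (\<rho> * x) ^ k * (\<rho> * x) powi (- int n)"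
      using assms by (simp add: power_diff power_int_minus divide_inverse)
    then show "D_coeff \<rho> k n * \<rho> ^ (k - n) * (x ^ (k - n) * exp x) =
        (\<rho> * x) ^ k * exp x * (D_coeff \<rho> k n * (\<rho> * x) powi (- int n))"
      by (simp add: power_mult_distrib mult_ac)
  qed simp
  \<comment> \<open>Positivity of \<open>k\<close> keeps \<open>k-1\<close> from being truncated;
    for \<open>k = 0\<close> the right side would be \<open>{0}\<close>.\<close>
  also have "{..<k} = {0..k-1}"
    using assms(1) by auto
  finally show ?thesis
    by (simp only: sum_distrib_left)
qed

end
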